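(* Consider the $k$-Means with missing values problem in $\mathbb{R}^d_{?}$ where each point can have at most $j$ missing coordinates. Assume there is an algorithm that constructs an $\epsilon$-coreset of size $f(j,k)\cdot \mathrm{poly}(\epsilon^{-1}d\log n)$; then $f(j,k)$ cannot be as small as $2^{o(\min(j,k))}$.
   Context: Points are vectors in $\mathbb{R}_?^d := (\mathbb{R}\cup\{?\})^d$, where a coordinate equal to ``?'' is missing. For $x\in\mathbb{R}_?^d$ and $c\in\mathbb{R}^d$, $\mathrm{dist}(x,c) := \sqrt{\sum_{i: x_i\neq ?}(x_i-c_i)^2}$, and $\mathrm{dist}(x,C):=\min_{c\in C}\mathrm{dist}(x,c)$. For a data set $X\subset\mathbb{R}_?^d$ of $n$ points, the $k$-Means cost of a center set $C\subset\mathbb{R}^d$, $|C|=k$, is $\mathrm{cost}_2(X,C)=\sum_{x\in X}\mathrm{dist}^2(x,C)$. A weighted subset $S\subseteq X$ with weights $w:S\to\mathbb{R}_+$ is an $\epsilon$-coreset if for every $C\subset\mathbb{R}^d$ with $|C|=k$, $\sum_{x\in S}w(x)\,\mathrm{dist}^2(x,C)\in(1\pm\epsilon)\,\mathrm{cost}_2(X,C)$. *)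

theory Defs
  imports
    "Jordan_Normal_Form.Matrix"
    "HOL-Computational_Algebra.Polynomial"
    "HOL-Library.Landau_Symbols"
begin

text \<open>
  A point with missing values is a vector of type \<open>real option vec\<close>, where \<open>None\<close> stands for
  the symbol ``?''. The dimension varies inside the statement, so it is given by \<open>carrier_vec d\<close>.
\<close>

definition missing :: "real option vec \<Rightarrow> nat set" where
  "missing x = {i. i < dim_vec x \<and> x $ i = None}"

definition mdist :: "real option vec \<Rightarrow> real vec \<Rightarrow> real" where
  "mdist x c = sqrt (\<Sum>i \<in> {..<dim_vec x} - missing x. (the (x $ i) - c $ i)\<^sup>2)"

text \<open>Only meaningful for finite nonempty \<open>C\<close>.\<close>

definition mdist_set :: "real option vec \<Rightarrow> real vec set \<Rightarrow> real" where
  "mdist_set x C = Min (mdist x ` C)"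

definition kmeans_cost :: "real option vec set \<Rightarrow> real vec set \<Rightarrow> real" where
  "kmeans_cost X C = (\<Sum>x\<in>X. (mdist_set x C)\<^sup>2)"

definition is_coreset ::
  "nat \<Rightarrow> nat \<Rightarrow> real \<Rightarrow> real option vec set \<Rightarrow> real option vec set \<Rightarrow> (real option vec \<Rightarrow> real) \<Rightarrow> bool"
where
  "is_coreset d k \<epsilon> X S w \<longleftrightarrow>
     S \<subseteq> X \<and> (\<forall>x\<in>S. 0 \<le> w x) \<and>
     (\<forall>C. C \<subseteq> carrier_vec d \<and> finite C \<and> card C = k \<longrightarrow>
        (\<Sum>x\<in>S. w x * (mdist_set x C)\<^sup>2)
          \<in> {(1 - \<epsilon>) * kmeans_cost X C .. (1 + \<epsilon>) * kmeans_cost X C})"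

text \<open>
  An algorithm is an arbitrary map from the input \<open>(d, j, k, \<epsilon>, X)\<close> to a weighted set \<open>(S, w)\<close>;
  no computability is required. The polynomial \<open>p\<close> in the product \<open>d log n / \<epsilon>\<close> absorbs
  the base of the logarithm. The condition \<open>n \<ge> 2\<close> excludes \<open>log n = 0\<close>, where a size bound
  such as \<open>(d log n / \<epsilon>)\<^sup>2\<close> would leave no room for even a single point.
\<close>

definition constructs_coresets ::
  "(nat \<Rightarrow> nat \<Rightarrow> nat \<Rightarrow> real \<Rightarrow> real option vec set \<Rightarrow>
      real option vec set \<times> (real option vec \<Rightarrow> real)) \<Rightarrow>
    (nat \<Rightarrow> nat \<Rightarrow> real) \<Rightarrow> real poly \<Rightarrow> bool"
where
  "constructs_coresets A f p \<longleftrightarrow>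
     (\<forall>d j k n \<epsilon> X. d \<ge> 1 \<and> k \<ge> 1 \<and> n \<ge> 2 \<and> 0 < \<epsilon> \<and> \<epsilon> < 1 \<and>
        X \<subseteq> carrier_vec d \<and> finite X \<and> card X = n \<and> (\<forall>x\<in>X. card (missing x) \<le> j) \<longrightarrow>
        (case A d j k \<epsilon> X of (S, w) \<Rightarrow>
           is_coreset d k \<epsilon> X S w \<and>
           real (card S) \<le> f j k * poly p (inverse \<epsilon> * real d * ln (real n))))"

text \<open>The class \<open>2^{o(min(j,k))}\<close>, with the asymptotics taken as \<open>min(j,k)\<close> tends to infinity.\<close>

definition subexp_min :: "(nat \<Rightarrow> nat \<Rightarrow> real) \<Rightarrow> bool" where
  "subexp_min f \<longleftrightarrow>
     (\<exists>g. g \<in> o[filtercomap (\<lambda>(j, k). min j k) at_top](\<lambda>(j, k). real (min j k)) \<and>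
        (\<forall>\<^sub>F (j, k) in filtercomap (\<lambda>(j, k). min j k) at_top. f j k \<le> 2 powr g (j, k)))"

end

theory Submission
  imports Defs "HOL-Real_Asymp.Real_Asymp"
begin

text \<open>
  Encode a subset \<open>T\<close> of \<open>{..<m}\<close> as a point of dimension \<open>2m\<close> all of whose present coordinates
  are \<open>0\<close>: of the pair of coordinates \<open>i\<close>, \<open>m + i\<close> the first is missing if \<open>i \<in> T\<close>, and the
  second is missing otherwise. For a fixed \<open>T\<close> take as centers the \<open>m\<close> unit vectors
  in the directions that are present in the code of \<open>T\<close>. Every \<open>U \<noteq> T\<close> differs from \<open>T\<close> in
  some \<open>i\<close>, so the corresponding direction is missing in the code of \<open>U\<close>, which therefore has
  cost \<open>0\<close>, whereas the code of \<open>T\<close> has cost \<open>1\<close>. Hence a coreset with relative error below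
  \<open>1\<close> omits none of the \<open>2\<^sup>m\<close> points, although \<open>j = k = m\<close> and \<open>d\<close>, \<open>log n\<close> are linear in \<open>m\<close>.
\<close>

definition subset_point :: "nat \<Rightarrow> nat set \<Rightarrow> real option vec" where
  "subset_point m T =
     vec (2 * m) (\<lambda>i. if (if i < m then i \<in> T else i - m \<notin> T) then None else Some 0)"

definition present_dir :: "nat \<Rightarrow> nat set \<Rightarrow> nat \<Rightarrow> nat" where
  "present_dir m T i = (if i \<in> T then m + i else i)"

definition separating_centers :: "nat \<Rightarrow> nat set \<Rightarrow> real vec set" where
  "separating_centers m T = (\<lambda>i. unit_vec (2 * m) (present_dir m T i)) ` {..<m}"

lemma dim_subset_point [simp]: "dim_vec (subset_point m T) = 2 * m"
  by (simp add: subset_point_def)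

lemma missing_subset_point:
  "missing (subset_point m T) = {i. i < 2 * m \<and> (if i < m then i \<in> T else i - m \<notin> T)}"
  by (auto simp: missing_def subset_point_def split: if_splits)

text \<open>Each pair \<open>i\<close>, \<open>m + i\<close> loses exactly one coordinate, so the
  codes respect the limit on missing values for \<open>j = m\<close>.\<close>

lemma card_missing_subset_point:
  "card (missing (subset_point m T)) = m"
proof -
  have "bij_betw (\<lambda>i. if i \<in> T then i else m + i) {..<m} (missing (subset_point m T))"
  proof (rule bij_betwI')
    fix y assume "y \<in> missing (subset_point m T)"
    then show "\<exists>x\<in>{..<m}. y = (if x \<in> T then x else m + x)"
      by (intro bexI[of _ "if y < m then y else y - m"])
         (auto simp: missing_subset_point split: if_splits)
  qed (auto simp: missing_subset_point)
  then show ?thesis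
    using bij_betw_same_card by fastforce
qed

lemma inj_on_subset_point: "inj_on (subset_point m) (Pow {..<m})"
proof (rule inj_onI)
  fix T U assume "T \<in> Pow {..<m}" "U \<in> Pow {..<m}" "subset_point m T = subset_point m U"
  \<comment> \<open>Below \<open>m\<close>, the missing positions spell out the encoded subset
    itself.\<close>
  moreover have "V = missing (subset_point m V) \<inter> {..<m}" if "V \<in> Pow {..<m}" for V
    using that by (auto simp: missing_subset_point)
  ultimately show "T = U"
    by metis
qed

text \<open>All present coordinates are \<open>0\<close>, so only coordinate \<open>l\<close> can
  contribute to the distance.\<close>

lemma mdist_subset_point_unit_vec:
  assumes "l < 2 * m"
  shows "mdist (subset_point m T) (unit_vec (2 * m) l) =
         (if l \<in> missing (subset_point m T) then 0 else 1)"
proof -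
  let ?x = "subset_point m T"
  have "(\<Sum>i \<in> {..<2 * m} - missing ?x. (the (?x $ i) - unit_vec (2 * m) l $ i)\<^sup>2) =
        (\<Sum>i \<in> {..<2 * m} - missing ?x. if i = l then 1 else (0 :: real))"
    using assms by (intro sum.cong refl) (auto simp: missing_def subset_point_def)
  also have "\<dots> = (if l \<in> missing ?x then 0 else 1)"
    using assms by (subst sum.delta) auto
  finally show ?thesis
    by (simp add: mdist_def)
qed

text \<open>The chosen coordinate is present in the code of \<open>T\<close>, hence missing in that
  of \<open>U\<close> exactly when the two sets disagree on \<open>i\<close>.\<close>

lemma mdist_present_dir:
  assumes "i < m"
  shows "mdist (subset_point m U) (unit_vec (2 * m) (present_dir m T i)) =
         (if i \<in> T \<longleftrightarrow> i \<in> U then 1 else 0)"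
  using assms
  by (subst mdist_subset_point_unit_vec) (auto simp: present_dir_def missing_subset_point)

lemma separating_centers_carrier: "separating_centers m T \<subseteq> carrier_vec (2 * m)"
  by (auto simp: separating_centers_def)

lemma finite_separating_centers: "finite (separating_centers m T)"
  by (simp add: separating_centers_def)

text \<open>Coresets are tested only on sets of exactly \<open>k\<close> centers. Distinct pairs
  give distinct directions, so \<open>k = m\<close> is met.\<close>

lemma card_separating_centers: "card (separating_centers m T) = m"
proof -
  have "inj_on (\<lambda>i. unit_vec (2 * m) (present_dir m T i) :: real vec) {..<m}"
    by (rule inj_onI) (auto simp: present_dir_def split: if_splits)
  then show ?thesis
    by (simp add: separating_centers_def card_image)
qed

lemma mdist_set_separating_centers:
  assumes "0 < m" "T \<subseteq> {..<m}" "U \<subseteq> {..<m}"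
  shows "mdist_set (subset_point m U) (separating_centers m T) = (if U = T then 1 else 0)"
proof -
  have img: "mdist (subset_point m U) ` separating_centers m T =
      (\<lambda>i. if i \<in> T \<longleftrightarrow> i \<in> U then 1 else 0) ` {..<m}"
    unfolding separating_centers_def image_image
    by (intro image_cong refl) (simp add: mdist_present_dir)
  show ?thesis
  proof (cases "U = T")
    case True
    \<comment> \<open>With \<open>0 < m\<close> there is at least one center, so the image is not
      empty.\<close>
    then have "mdist (subset_point m U) ` separating_centers m T = {1}"
      using assms(1) unfolding img by auto
    then show ?thesis
      using True by (simp add: mdist_set_def)
  next
    case False
    then obtain i where "i < m" "(i \<in> T) \<noteq> (i \<in> U)"
      using assms by blast
    then have "(0 :: real) \<in> (\<lambda>i. if i \<in> T \<longleftrightarrow> i \<in> U then 1 else 0) ` {..<m}"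
      by (intro image_eqI[of _ _ i]) auto
    then show ?thesis
      using False unfolding mdist_set_def img by (intro Min_eqI) auto
  qed
qed

lemma coreset_subset_points_full:
  assumes "0 < m" "\<epsilon> < 1"
    and core: "is_coreset (2 * m) m \<epsilon> (subset_point m ` Pow {..<m}) S w"
  shows "S = subset_point m ` Pow {..<m}"
proof (rule ccontr)
  let ?X = "subset_point m ` Pow {..<m}"
  assume "S \<noteq> ?X"
  moreover have sub: "S \<subseteq> ?X"
    using core by (simp add: is_coreset_def)
  ultimately obtain T where T: "T \<subseteq> {..<m}" "subset_point m T \<notin> S"
    by blast
  let ?C = "separating_centers m T"
  have "kmeans_cost ?X ?C = (\<Sum>U\<in>Pow {..<m}. if U = T then 1 else 0)"
    unfolding kmeans_cost_def
    by (subst sum.reindex[OF inj_on_subset_point], intro sum.cong refl)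
       (use assms(1) T in \<open>auto simp: mdist_set_separating_centers\<close>)
  also have "\<dots> = 1"
    using T by (subst sum.delta) auto
  finally have cost: "kmeans_cost ?X ?C = 1" .
  have "(\<Sum>x\<in>S. w x * (mdist_set x ?C)\<^sup>2)
      \<in> {(1 - \<epsilon>) * kmeans_cost ?X ?C .. (1 + \<epsilon>) * kmeans_cost ?X ?C}"
    by (rule core[unfolded is_coreset_def, THEN conjunct2, THEN conjunct2, rule_format])
       (simp add: separating_centers_carrier finite_separating_centers card_separating_centers)
  then have "1 - \<epsilon> \<le> (\<Sum>x\<in>S. w x * (mdist_set x ?C)\<^sup>2)"
    unfolding cost by simp
  \<comment> \<open>Every point left in \<open>S\<close> encodes some \<open>U \<noteq> T\<close>
    and lies at distance \<open>0\<close> from the centers, so no choice of weights helps.\<close>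
  also have "\<dots> = 0"
  proof (intro sum.neutral ballI)
    fix x assume "x \<in> S"
    then obtain U where "U \<subseteq> {..<m}" "x = subset_point m U" "U \<noteq> T"
      using sub T by blast
    then show "w x * (mdist_set x ?C)\<^sup>2 = 0"
      using assms(1) T by (simp add: mdist_set_separating_centers)
  qed
  finally show False
    using assms(2) by simp
qed

text \<open>The instance has \<open>d = 2 * m\<close>, \<open>n = 2 ^ m\<close> and error
  \<open>1 / 2\<close>, which makes the argument of \<open>p\<close> quadratic in
  \<open>m\<close>.\<close>

lemma coreset_size_lower_bound:
  assumes "constructs_coresets A f p" "0 < m"
  shows "2 ^ m \<le> f m m * poly p (4 * ln 2 * (real m)\<^sup>2)"
proof -
  let ?X = "subset_point m ` Pow {..<m}"
  obtain S w where Sw: "A (2 * m) m m (1 / 2) ?X = (S, w)"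
    by force
  have card: "card ?X = 2 ^ m"
    by (simp add: card_image inj_on_subset_point card_Pow)
  have "(2 :: nat) ^ 1 \<le> 2 ^ m"
    using assms(2) by (intro power_increasing) auto
  moreover have "?X \<subseteq> carrier_vec (2 * m)"
    by (auto intro!: carrier_vecI)
  ultimately have "is_coreset (2 * m) m (1 / 2) ?X S w"
    and size: "real (card S) \<le>
      f m m * poly p (inverse (1 / 2) * real (2 * m) * ln (real (2 ^ m)))"
    using assms(1)[unfolded constructs_coresets_def, rule_format,
        of "2 * m" m "2 ^ m" "1 / 2" ?X m] assms(2) Sw card
    by (auto simp: card_missing_subset_point)
  then have "S = ?X"
    using assms(2) by (intro coreset_subset_points_full) auto
  moreover have arg: "inverse (1 / 2) * real (2 * m) * ln (real (2 ^ m)) = 4 * ln 2 * (real m)\<^sup>2"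
    by (simp add: ln_realpow power2_eq_square)
  ultimately show ?thesis
    using size[unfolded arg] card by simp
qed

lemma poly_square_smallo_exp:
  fixes p :: "real poly"
  assumes "1 < b"
  shows "(\<lambda>m. poly p (a * (real m)\<^sup>2)) \<in> o(\<lambda>m. b powr real m)"
  unfolding poly_altdef
proof (rule big_sum_in_smallo)
  fix i
  have "(\<lambda>m. real m ^ (2 * i)) \<in> o(\<lambda>m. b powr real m)"
    using assms by real_asymp
  then have "(\<lambda>m. (coeff p i * a ^ i) * real m ^ (2 * i)) \<in> o(\<lambda>m. b powr real m)"
    by (cases "coeff p i * a ^ i = 0") simp_all
  then show "(\<lambda>m. coeff p i * (a * (real m)\<^sup>2) ^ i) \<in> o(\<lambda>m. b powr real m)"
    by (simp add: power_mult_distrib power_mult mult.assoc)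
qed

text \<open>Along the diagonal \<open>min j k\<close> is \<open>m\<close>, so the two-variable
  asymptotics pull back to a limit in \<open>m\<close> alone.\<close>

lemma subexp_min_diagonal:
  assumes "subexp_min f" "0 < c"
  shows "\<forall>\<^sub>F m in at_top. f m m \<le> 2 powr (c * real m)"
proof -
  obtain g where g: "g \<in> o[filtercomap (\<lambda>(j, k). min j k) at_top](\<lambda>(j, k). real (min j k))"
    and le: "\<forall>\<^sub>F (j, k) in filtercomap (\<lambda>(j, k). min j k) at_top. f j k \<le> 2 powr g (j, k)"
    using assms(1) unfolding subexp_min_def by blast
  have diag: "filterlim (\<lambda>m :: nat. (m, m)) (filtercomap (\<lambda>(j, k). min j k) at_top) at_top"
    by (simp add: filterlim_filtercomap_iff o_def filterlim_ident)
  have "\<forall>\<^sub>F m in at_top. \<bar>g (m, m)\<bar> \<le> c * real m"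
    using eventually_compose_filterlim[OF landau_o.smallD[OF g assms(2)] diag] by simp
  moreover have "\<forall>\<^sub>F m in at_top. f m m \<le> 2 powr g (m, m)"
    using eventually_compose_filterlim[OF le diag] by simp
  ultimately show ?thesis
  proof eventually_elim
    case (elim m)
    have "2 powr g (m, m) \<le> 2 powr (c * real m)"
      using elim(1) by (intro powr_mono) auto
    then show ?case
      using elim(2) by linarith
  qed
qed

theorem theorem1p2:
  fixes A :: "nat \<Rightarrow> nat \<Rightarrow> nat \<Rightarrow> real \<Rightarrow> real option vec set \<Rightarrow>
      real option vec set \<times> (real option vec \<Rightarrow> real)"
    and f :: "nat \<Rightarrow> nat \<Rightarrow> real"
    and p :: "real poly"
  assumes "\<And>j k. 0 \<le> f j k"
    and "constructs_coresets A f p"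
  shows "\<not> subexp_min f"
proof
  assume "subexp_min f"
  \<comment> \<open>The exponential \<open>2 ^ m\<close> is split evenly: \<open>f\<close> and the
    polynomial each stay below \<open>sqrt 2 powr real m\<close>, and an extra factor
    \<open>1 / 2\<close> for the polynomial makes the final inequality absurd.\<close>
  then have "\<forall>\<^sub>F m in at_top. f m m \<le> 2 powr (1 / 2 * real m)"
    by (rule subexp_min_diagonal) simp
  moreover have "\<forall>\<^sub>F m in at_top. \<bar>poly p (4 * ln 2 * (real m)\<^sup>2)\<bar> \<le> 1 / 2 * sqrt 2 powr real m"
    using landau_o.smallD[OF poly_square_smallo_exp[of "sqrt 2" p "4 * ln 2"], of "1 / 2"] by simp
  moreover have "\<forall>\<^sub>F m :: nat in at_top. 0 < m"
    by (rule eventually_gt_at_top)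
  ultimately have "\<forall>\<^sub>F m :: nat in at_top. False"
  proof eventually_elim
    case (elim m)
    have sqrt2: "sqrt 2 powr real m = 2 powr (1 / 2 * real m)"
      by (simp add: powr_half_sqrt[symmetric] powr_powr)
    have "2 ^ m \<le> f m m * poly p (4 * ln 2 * (real m)\<^sup>2)"
      using assms(2) elim(3) by (rule coreset_size_lower_bound)
    \<comment> \<open>The polynomial is bounded first, using \<open>0 \<le> f m m\<close>; its bound
      is nonnegative, so \<open>f\<close> can be bounded next whatever the sign of the
      polynomial.\<close>
    also have "\<dots> \<le> 2 powr (1 / 2 * real m) * (1 / 2 * 2 powr (1 / 2 * real m))"
      using elim(1,2) assms(1) unfolding sqrt2 abs_le_iff
      by (intro order_trans[OF mult_left_mono mult_right_mono]) auto
    also have "\<dots> = 1 / 2 * 2 ^ m"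
      by (simp add: powr_add[symmetric] powr_realpow)
    finally show False
      by simp
  qed
  then show False
    by simp
qed

end
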